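(* Let $\mathcal R=(\mathbb C^2,\|\cdot\|_{\mathcal R})$ be a complex Radon plane and let $(\mathbb C^2,\|\cdot\|_2)$ be the Hilbert space with the norm $\|(x,y)\|_2=\sqrt{|x|^2+|y|^2}$. Then the following conditions are equivalent: (i) $\Gamma_0(\mathcal R)$ is isomorphic to $\Gamma_0(\mathbb C^2,\|\cdot\|_2)$. (ii) (a) The boundary points of each nonzero-dimensional face in $\mathcal R$ are smooth, and (b) the set $\{x^\perp : x\in\Gamma_0(\mathcal R)\}$ has the cardinality of the continuum.
   Context: For $x,y$ in a complex normed space $\mathcal X$, $x\perp y$ (Birkhoff--James orthogonality) means $\|x+\lambda y\|\ge\|x\|$ for all $\lambda\in\mathbb C$. A complex Radon plane is a complex normed space of complex dimension two in which $\perp$ is symmetric. $\Gamma_0(\mathcal X)$ is the directed graph whose vertices are all vectors of $\mathcal X$, with an edge $x\rightarrow y$ if and only if $x\perp y$; $x^\perp=\{y : x\rightarrow y\}$; an isomorphism of digraphs is a bijection of vertices preserving edges in both directions. A nonzero vector $x$ is smooth if it has a unique supporting functional ($\mathbb C$-linear $f\in\mathcal X^*$ with $\|f\|=1$, $f(x)=\|x\|$). A face of the norm's unit ball is a convex subset $F$ of the unit sphere such that if $x,y$ are distinct normalized vectors whose open line segment $\{\lambda x+(1-\lambda)y : 0<\lambda<1\}$ intersects $F$, then $x,y\in F$. The dimension of a face is its real affine dimension, and its boundary points are the points of its relative boundary (in its real affine span). *)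

theory Defs
  imports "HOL-Analysis.Analysis" "HOL-Library.Equipollence"
begin

text \<open>
  A norm on the complex vector space of \<open>n\<close>-tuples is an explicit function \<open>N\<close>; it is unrelated to
  the type class norm of \<^typ>\<open>complex^'n\<close>. Nonnegativity follows from the three conditions.
\<close>

definition complex_norm :: "(complex^'n \<Rightarrow> real) \<Rightarrow> bool" where
  "complex_norm N \<longleftrightarrow>
     (\<forall>x. N x = 0 \<longleftrightarrow> x = 0) \<and>
     (\<forall>c x. N (c *s x) = cmod c * N x) \<and>
     (\<forall>x y. N (x + y) \<le> N x + N y)"

definition hilbert_norm :: "complex^2 \<Rightarrow> real" where
  "hilbert_norm v = sqrt ((cmod (v $ 1))\<^sup>2 + (cmod (v $ 2))\<^sup>2)"

definition BJ_orthogonal :: "(complex^'n \<Rightarrow> real) \<Rightarrow> complex^'n \<Rightarrow> complex^'n \<Rightarrow> bool" where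
  "BJ_orthogonal N x y \<longleftrightarrow> (\<forall>c::complex. N (x + c *s y) \<ge> N x)"

definition complex_Radon_plane :: "(complex^2 \<Rightarrow> real) \<Rightarrow> bool" where
  "complex_Radon_plane N \<longleftrightarrow>
     complex_norm N \<and> (\<forall>x y. BJ_orthogonal N x y \<longrightarrow> BJ_orthogonal N y x)"

text \<open>
  A digraph whose vertices are all elements of a type is given by its edge relation; loops are
  allowed (the zero vector carries one in \<open>Gamma0\<close>).
\<close>

definition Gamma0 :: "(complex^'n \<Rightarrow> real) \<Rightarrow> (complex^'n) rel" where
  "Gamma0 N = {(x, y). BJ_orthogonal N x y}"

definition out_perp :: "(complex^'n \<Rightarrow> real) \<Rightarrow> complex^'n \<Rightarrow> (complex^'n) set" where
  "out_perp N x = {y. (x, y) \<in> Gamma0 N}"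

definition digraph_isomorphic :: "'a rel \<Rightarrow> 'b rel \<Rightarrow> bool" where
  "digraph_isomorphic E E' \<longleftrightarrow>
     (\<exists>\<phi>::'a \<Rightarrow> 'b. bij \<phi> \<and> (\<forall>x y. (x, y) \<in> E \<longleftrightarrow> (\<phi> x, \<phi> y) \<in> E'))"

definition dual_norm :: "(complex^'n \<Rightarrow> real) \<Rightarrow> (complex^'n \<Rightarrow> complex) \<Rightarrow> real" where
  "dual_norm N f = (SUP x\<in>{x. N x \<le> 1}. cmod (f x))"

definition supporting_functional ::
    "(complex^'n \<Rightarrow> real) \<Rightarrow> complex^'n \<Rightarrow> (complex^'n \<Rightarrow> complex) \<Rightarrow> bool" where
  "supporting_functional N x f \<longleftrightarrow>
     Vector_Spaces.linear (*s) (*) f \<and> dual_norm N f = 1 \<and> f x = complex_of_real (N x)"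

definition smooth_vector :: "(complex^'n \<Rightarrow> real) \<Rightarrow> complex^'n \<Rightarrow> bool" where
  "smooth_vector N x \<longleftrightarrow> x \<noteq> 0 \<and> (\<exists>!f. supporting_functional N x f)"

definition ball_face :: "(complex^'n \<Rightarrow> real) \<Rightarrow> (complex^'n) set \<Rightarrow> bool" where
  "ball_face N F \<longleftrightarrow>
     convex F \<and> F \<subseteq> {x. N x = 1} \<and>
     (\<forall>x y. N x = 1 \<and> N y = 1 \<and> x \<noteq> y \<and> open_segment x y \<inter> F \<noteq> {} \<longrightarrow> x \<in> F \<and> y \<in> F)"

text \<open>
  \<^const>\<open>aff_dim\<close> is the real affine dimension, and \<^const>\<open>rel_frontier\<close> the boundary in the real
  affine span. The latter refers to the Euclidean topology, which is the topology of every norm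
  \<open>N\<close> since the dimension is finite. The empty face has \<^const>\<open>aff_dim\<close> \<open>-1\<close> and no boundary points.
\<close>

definition face_boundaries_smooth :: "(complex^'n \<Rightarrow> real) \<Rightarrow> bool" where
  "face_boundaries_smooth N \<longleftrightarrow>
     (\<forall>F. ball_face N F \<and> aff_dim F \<noteq> 0 \<longrightarrow> (\<forall>x \<in> rel_frontier F. smooth_vector N x))"

end

theory Submission
  imports Defs
begin

text \<open>
  On \<open>\<complex>\<^sup>2\<close> every linear functional is \<open>v \<mapsto> det (v, w)\<close> for a unique \<open>w\<close>, so supporting functionals at
  \<open>x\<close> correspond to suitably scaled nonzero vectors orthogonal to \<open>x\<close>, and \<open>x\<close> is smooth iff these form
  a single line. Both conditions on the norm turn out to be tied to one property: two nonzero
  vectors with a common nonzero neighbour have the same neighbourhood. It clearly holds in the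
  Hilbert plane and is invariant under isomorphism; conversely, together with symmetry it says
  that, off the zero vector, the graph is a disjoint union of complete bipartite graphs whose
  sides have the cardinality of the continuum, so that only the number of components remains,
  which is what (b) prescribes. The property forces all points of a nondegenerate face to be smooth.
  In the other direction, the normalised vectors orthogonal to a given \<open>x\<close> form a face, whose relative
  interior points are smooth for free and whose boundary points are smooth by (a).
\<close>

section \<open>Disjoint unions of complete bipartite graphs\<close>

lemma digraph_isomorphic_sym:
  assumes "digraph_isomorphic E E'"
  shows "digraph_isomorphic E' E"
proof -
  obtain \<phi> where \<phi>: "bij \<phi>" "\<And>x y. (x, y) \<in> E \<longleftrightarrow> (\<phi> x, \<phi> y) \<in> E'"
    using assms unfolding digraph_isomorphic_def by blast
  have "(x, y) \<in> E' \<longleftrightarrow> (inv \<phi> x, inv \<phi> y) \<in> E" for x y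
    by (simp add: \<phi>(2) bij_is_surj[OF \<phi>(1)] surj_f_inv_f)
  then show ?thesis
    unfolding digraph_isomorphic_def using bij_imp_bij_inv[OF \<phi>(1)] by blast
qed

lemma digraph_isomorphic_trans:
  assumes "digraph_isomorphic E E'" "digraph_isomorphic E' E''"
  shows "digraph_isomorphic E E''"
proof -
  obtain \<phi> where \<phi>: "bij \<phi>" "\<And>x y. (x, y) \<in> E \<longleftrightarrow> (\<phi> x, \<phi> y) \<in> E'"
    using assms unfolding digraph_isomorphic_def by blast
  obtain \<psi> where \<psi>: "bij \<psi>" "\<And>x y. (x, y) \<in> E' \<longleftrightarrow> (\<psi> x, \<psi> y) \<in> E''"
    using assms unfolding digraph_isomorphic_def by blast
  have "(x, y) \<in> E \<longleftrightarrow> ((\<psi> \<circ> \<phi>) x, (\<psi> \<circ> \<phi>) y) \<in> E''" for x y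
    by (simp add: \<phi>(2) \<psi>(2))
  then show ?thesis
    unfolding digraph_isomorphic_def using bij_comp[OF \<phi>(1) \<psi>(1)] by blast
qed

text \<open>The image map of an isomorphism is a bijection between the two families of
  out-neighbourhoods, so the cardinality in (b) is an invariant of the graph.\<close>

lemma digraph_isomorphic_range_Image:
  assumes "digraph_isomorphic E E'"
  shows "range (\<lambda>x. E `` {x}) \<approx> range (\<lambda>x. E' `` {x})"
proof -
  obtain \<phi> where \<phi>: "bij \<phi>" "\<And>x y. (x, y) \<in> E \<longleftrightarrow> (\<phi> x, \<phi> y) \<in> E'"
    using assms unfolding digraph_isomorphic_def by blast
  have img: "\<phi> ` (E `` {x}) = E' `` {\<phi> x}" for x
  proof (intro equalityI subsetI)
    fix y assume "y \<in> E' `` {\<phi> x}"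
    moreover obtain y' where "y = \<phi> y'" using bij_is_surj[OF \<phi>(1)] by blast
    ultimately show "y \<in> \<phi> ` (E `` {x})" using \<phi>(2) by auto
  qed (use \<phi>(2) in auto)
  have "range (\<lambda>x. E' `` {x}) = (\<lambda>x. E' `` {x}) ` \<phi> ` UNIV"
    using bij_is_surj[OF \<phi>(1)] by simp
  also have "\<dots> = image \<phi> ` range (\<lambda>x. E `` {x})"
    by (simp add: image_image img)
  finally have eq: "range (\<lambda>x. E' `` {x}) = image \<phi> ` range (\<lambda>x. E `` {x})" .
  have "inj_on (image \<phi>) (range (\<lambda>x. E `` {x}))"
    by (meson bij_is_inj[OF \<phi>(1)] inj_image_eq_iff inj_onI)
  then show ?thesis
    unfolding eq by (simp add: eqpoll_sym inj_on_image_eqpoll_self)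
qed

section \<open>The model graph and its characterisation\<close>

lemma infinite_times_self_eqpoll: "infinite A \<Longrightarrow> A \<times> A \<approx> A"
  using card_of_Times_same_infinite eqpoll_iff_card_of_ordIso by blast

text \<open>
  Apart from the apex \<^const>\<open>None\<close>, joined to everything, a vertex \<open>Some (a, i, c)\<close> is the point \<open>c\<close> on
  the side \<open>i\<close> of the component \<open>a\<close>.
\<close>

definition biclique_sum :: "(real \<times> bool \<times> real) option rel" where
  "biclique_sum =
     {(u, v). \<forall>a i c b j d. u = Some (a, i, c) \<and> v = Some (b, j, d) \<longrightarrow> a = b \<and> i \<noteq> j}"

text \<open>The axioms pin the graph down up to isomorphism: equal neighbourhoods group the vertices
  other than \<open>z\<close> into sides, \<open>class_continuum\<close> gives the size of a side
  and \<open>nbhds_continuum\<close> the number of sides.\<close>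

locale biclique_graph =
  fixes E :: "'a rel" and z :: 'a
  assumes sym_edge: "(x, y) \<in> E \<Longrightarrow> (y, x) \<in> E"
    and apex: "(z, x) \<in> E"
    and no_loop: "x \<noteq> z \<Longrightarrow> (x, x) \<notin> E"
    and has_mate: "x \<noteq> z \<Longrightarrow> \<exists>y. y \<noteq> z \<and> (x, y) \<in> E"
    and same_nbhd: "x \<noteq> z \<Longrightarrow> x' \<noteq> z \<Longrightarrow> y \<noteq> z \<Longrightarrow> (x, y) \<in> E \<Longrightarrow> (x', y) \<in> E \<Longrightarrow>
        E `` {x} = E `` {x'}"
    and class_continuum: "x \<noteq> z \<Longrightarrow> {x'. E `` {x'} = E `` {x}} \<approx> (UNIV :: real set)"
    and nbhds_continuum: "range (\<lambda>x. E `` {x}) \<approx> (UNIV :: real set)"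
begin

text \<open>Sides are named by neighbourhoods, and adjacency pairs them off by an involution
  \<open>mate\<close> without fixed points. Choosing one side from each pair names the components,
  of which there are continuum many, and each side is enumerated by the reals.\<close>

lemma isomorphic_biclique_sum: "digraph_isomorphic E biclique_sum"
proof -
  define nb where "nb x = E `` {x}" for x
  have nb_iff: "y \<in> nb x \<longleftrightarrow> (x, y) \<in> E" for x y by (simp add: nb_def)
  define S where "S = {nb x |x. x \<noteq> z}"
  have nbz: "nb z = UNIV" using apex by (auto simp: nb_def)
  have nb_UNIV: "nb x \<noteq> UNIV" if "x \<noteq> z" for x using no_loop[OF that] nb_iff by blast
  \<comment> \<open>The apex contributes only the neighbourhood \<open>UNIV\<close>, and removing
    one element from an infinite set keeps its cardinality.\<close>
  have "range nb = insert UNIV S" unfolding S_def using nbz by auto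
  then have ins: "insert UNIV S \<approx> (UNIV :: real set)" 
    using nbhds_continuum by (simp add: nb_def)
  then have infS: "infinite S" using infinite_UNIV_char_0 eqpoll_finite_iff finite.insertI by metis
  then have S_real: "S \<approx> (UNIV :: real set)"
    using ins by (meson infinite_insert_eqpoll eqpoll_sym eqpoll_trans)
  obtain p where p: "\<And>x. x \<noteq> z \<Longrightarrow> p x \<noteq> z \<and> (x, p x) \<in> E" using has_mate by metis
  \<comment> \<open>The representative picked by \<open>SOME\<close> is immaterial: by
    \<open>same_nbhd\<close>, all neighbours other than \<open>z\<close> of vertices with
    neighbourhood \<open>s\<close> share one neighbourhood.\<close>
  define mate where "mate s = nb (p (SOME x. x \<noteq> z \<and> nb x = s))" for s
  have edge: "(x, y) \<in> E \<longleftrightarrow> nb y = mate (nb x)" if "x \<noteq> z" "y \<noteq> z" for x y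
  proof -
    define x' where "x' = (SOME u. u \<noteq> z \<and> nb u = nb x)"
    have x': "x' \<noteq> z" "nb x' = nb x"
      using someI[of "\<lambda>u. u \<noteq> z \<and> nb u = nb x" x] that by (auto simp: x'_def)
    have e: "(x, p x') \<in> E" using p[OF x'(1)] x'(2) nb_iff by blast
    have m: "mate (nb x) = nb (p x')" by (simp add: mate_def x'_def)
    show ?thesis
    proof
      assume "(x, y) \<in> E"
      then show "nb y = mate (nb x)"
        using same_nbhd[of y "p x'" x] p[OF x'(1)] that e sym_edge m by (auto simp: nb_def)
    next
      assume "nb y = mate (nb x)"
      then show "(x, y) \<in> E" using m e sym_edge nb_iff by blast
    qed
  qed
  have mate_nb: "mate (nb x) = nb (p x)" if "x \<noteq> z" for x using edge[OF that] p[OF that] by metis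
  have mate_in: "mate s \<in> S" if s: "s \<in> S" for s
  proof -
    obtain x where x: "x \<noteq> z" "s = nb x" using s S_def by auto
    then have "mate s = nb (p x)" "p x \<noteq> z" using mate_nb p by auto
    then show ?thesis unfolding S_def by blast
  qed
  have mate_mate: "mate (mate s) = s" if s: "s \<in> S" for s
  proof -
    obtain x where x: "x \<noteq> z" "s = nb x" using s S_def by auto
    have "(p x, x) \<in> E" using p[OF x(1)] sym_edge by blast
    then show ?thesis using edge[of "p x" x] p[OF x(1)] x mate_nb by metis
  qed
  have mate_neq: "mate s \<noteq> s" if s: "s \<in> S" for s
    using s edge no_loop unfolding S_def by force
  \<comment> \<open>\<open>T\<close> contains exactly one of the two sides of each component.\<close>
  define T where "T = {s \<in> S. (SOME t. t \<in> {s, mate s}) = s}"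
  have T_iff: "mate s \<in> T \<longleftrightarrow> s \<notin> T" if s: "s \<in> S" for s
  proof -
    define c where "c = (SOME t. t \<in> {s, mate s})"
    have c: "c \<in> {s, mate s}" unfolding c_def by (rule someI[of _ s]) simp
    \<comment> \<open>Since \<open>s\<close> and \<open>mate s\<close> span the same pair, the
      choice operator selects the same element for both.\<close>
    have "{mate s, mate (mate s)} = {s, mate s}"
      using mate_mate[OF s] by (simp add: insert_commute)
    then have "mate s \<in> T \<longleftrightarrow> c = mate s" "s \<in> T \<longleftrightarrow> c = s"
      using s mate_in[OF s] by (simp_all only: T_def c_def mem_Collect_eq simp_thms)
    then show ?thesis using c mate_neq[OF s] by (metis insertE singletonD)
  qed
  \<comment> \<open>A side is encoded by the chosen side of its component and a flag. This bounds
    \<open>S\<close> by two copies of \<open>T\<close> and later yields two coordinates of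
    \<open>\<phi>\<close>.\<close>
  define g where "g s = (if s \<in> T then (s, True) else (mate s, False))" for s
  have "inj_on g S"
    by (rule inj_onI) (metis g_def mate_mate prod.inject)
  moreover have "g ` S \<subseteq> T \<times> UNIV" using T_iff by (auto simp: g_def)
  ultimately have S_le: "S \<lesssim> T \<times> (UNIV :: bool set)" unfolding lepoll_def by blast
  have TS: "T \<subseteq> S" by (auto simp: T_def)
  have infT: "infinite T"
  proof
    assume "finite T"
    then have "finite (T \<times> (UNIV :: bool set))" by simp
    then show False using S_le infS by (meson lepoll_def inj_on_finite)
  qed
  \<comment> \<open>The factor two is absorbed by the infinite set \<open>T\<close>, so there are as
    many components as sides.\<close>
  have "T \<times> (UNIV :: bool set) \<lesssim> T \<times> T"
    using times_lepoll_mono[OF lepoll_refl finite_lepoll_infinite[OF infT finite]] .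
  with S_le infinite_times_self_eqpoll[OF infT] have "S \<lesssim> T"
    by (meson lepoll_trans lepoll_trans2)
  then have "T \<approx> S" using TS by (simp add: lepoll_antisym subset_imp_lepoll)
  then obtain h where h: "bij_betw h T (UNIV :: real set)"
    using S_real eqpoll_trans eqpoll_def by metis
  have "\<exists>k. bij_betw k {x'. nb x' = nb x} (UNIV :: real set)" if "x \<noteq> z" for x
    using class_continuum[OF that] by (simp add: nb_def eqpoll_def)
  then have "\<exists>k. bij_betw k {x'. nb x' = s} (UNIV :: real set)" if "s \<in> S" for s
    using that S_def by auto
  then obtain k where k: "\<And>s. s \<in> S \<Longrightarrow> bij_betw (k s) {x'. nb x' = s} (UNIV :: real set)"
    by metis
  \<comment> \<open>The coordinates are the name of the component, the side within it and the
    position within the side.\<close>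
  define \<phi> where "\<phi> x = (if x = z then None else
      Some (h (fst (g (nb x))), snd (g (nb x)), k (nb x) x))" for x
  have nbS: "nb x \<in> S \<longleftrightarrow> x \<noteq> z" for x using nb_UNIV nbz unfolding S_def by auto
  have gT: "fst (g s) \<in> T" if "s \<in> S" for s using T_iff[OF that] by (auto simp: g_def)
  have h_inj: "h a = h b \<longleftrightarrow> a = b" if "a \<in> T" "b \<in> T" for a b
    using h that by (metis bij_betw_imp_inj_on inj_on_eq_iff)
  have g_eq: "g s = g t \<longleftrightarrow> s = t" if "s \<in> S" "t \<in> S" for s t
    using \<open>inj_on g S\<close> that by (simp add: inj_on_eq_iff)
  have g_mate: "g (mate s) = (fst (g s), \<not> snd (g s))" if "s \<in> S" for s
    using T_iff[OF that] mate_mate[OF that] by (auto simp: g_def)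
  have "inj \<phi>"
  proof (rule injI)
    fix x y assume eq: "\<phi> x = \<phi> y"
    show "x = y"
    proof (cases "x = z \<or> y = z")
      case False
      then have s: "nb x \<in> S" "nb y \<in> S" using nbS by auto
      have "fst (g (nb x)) = fst (g (nb y))" "snd (g (nb x)) = snd (g (nb y))"
        and ke: "k (nb x) x = k (nb y) y"
        using eq False h_inj gT s by (auto simp: \<phi>_def)
      then have "nb x = nb y" using g_eq[OF s] by (simp add: prod_eq_iff)
      then show ?thesis using ke bij_betw_imp_inj_on[OF k[OF s(1)]] by (auto dest: inj_onD)
    qed (use eq in \<open>auto simp: \<phi>_def split: if_splits\<close>)
  qed
  moreover have "surj \<phi>"
  proof -
    have "\<exists>x. \<phi> x = u" for u
    proof (cases u)
      case None then show ?thesis by (auto simp: \<phi>_def)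
    next
      case (Some w)
      obtain a i c where w: "u = Some (a, i, c)" using Some by (cases w) auto
      obtain t where t: "t \<in> T" "h t = a" using h by (metis UNIV_I bij_betw_iff_bijections)
      define s where "s = (if i then t else mate t)"
      have tS: "t \<in> S" using t TS by auto
      have s: "s \<in> S" "g s = (t, i)"
        using tS mate_in mate_mate T_iff t by (auto simp: s_def g_def)
      obtain x where x: "nb x = s" "k s x = c"
        using k[OF s(1)] unfolding bij_betw_def by (metis (mono_tags) UNIV_I image_iff mem_Collect_eq)
      then have "x \<noteq> z" using nbS s by auto
      then have "\<phi> x = u" by (simp add: \<phi>_def x s(2) t(2) w)
      then show ?thesis ..
    qed
    then show ?thesis by (metis surj_def)
  qed
  moreover have "(x, y) \<in> E \<longleftrightarrow> (\<phi> x, \<phi> y) \<in> biclique_sum" for x y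
  proof (cases "x = z \<or> y = z")
    case True
    then show ?thesis using apex sym_edge by (auto simp: \<phi>_def biclique_sum_def)
  next
    case False
    then have s: "nb x \<in> S" "nb y \<in> S" using nbS by auto
    have "(x, y) \<in> E \<longleftrightarrow> g (nb y) = g (mate (nb x))"
      using False edge g_eq s mate_in by auto
    also have "\<dots> \<longleftrightarrow> fst (g (nb x)) = fst (g (nb y)) \<and> snd (g (nb x)) \<noteq> snd (g (nb y))"
      by (auto simp: g_mate[OF s(1)] prod_eq_iff)
    also have "\<dots> \<longleftrightarrow> (\<phi> x, \<phi> y) \<in> biclique_sum"
      using False h_inj gT s by (auto simp: \<phi>_def biclique_sum_def)
    finally show ?thesis .
  qed
  ultimately show ?thesis unfolding digraph_isomorphic_def bij_def by blast
qed

end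

section \<open>Birkhoff--James orthogonality in the plane\<close>

definition wedge :: "complex^2 \<Rightarrow> complex^2 \<Rightarrow> complex" where
  "wedge v w = v $ 1 * w $ 2 - v $ 2 * w $ 1"

lemma wedge_simps:
  "wedge (v + v') w = wedge v w + wedge v' w"
  "wedge v (w + w') = wedge v w + wedge v w'"
  "wedge (v - v') w = wedge v w - wedge v' w"
  "wedge v (w - w') = wedge v w - wedge v w'"
  "wedge (c *s v) w = c * wedge v w"
  "wedge v (c *s w) = c * wedge v w"
  "wedge (r *\<^sub>R v) w = of_real r * wedge v w"
  "wedge v v = 0" "wedge 0 w = 0" "wedge v 0 = 0"
  by (simp_all add: wedge_def algebra_simps scaleR_conv_of_real[where 'a = complex])

lemma wedge_swap: "wedge w v = - wedge v w"
  by (simp add: wedge_def)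

text \<open>Cramer's rule without division, so that it also covers dependent \<open>x\<close> and
  \<open>y\<close>.\<close>

lemma wedge_cramer: "wedge x y *s v = wedge v y *s x + wedge x v *s y"
  by (simp add: vec_eq_iff forall_2 wedge_def algebra_simps)

lemma wedge_eq_0_iff:
  assumes "x \<noteq> 0"
  shows "wedge x y = 0 \<longleftrightarrow> (\<exists>c. y = c *s x)"
proof
  assume 0: "wedge x y = 0"
  show "\<exists>c. y = c *s x"
  proof (cases "x $ 1 = 0")
    case True
    then have "x $ 2 \<noteq> 0" using assms by (simp add: vec_eq_iff forall_2)
    then show ?thesis using True 0
      by (intro exI[of _ "y $ 2 / x $ 2"]) (simp add: vec_eq_iff forall_2 wedge_def field_simps)
  next
    case False
    then show ?thesis using 0
      by (intro exI[of _ "y $ 1 / x $ 1"]) (simp add: vec_eq_iff forall_2 wedge_def field_simps)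
  qed
qed (auto simp: wedge_simps)

lemma wedge_ext:
  assumes "\<And>v. wedge v w = wedge v w'"
  shows "w = w'"
  using assms[of "vector [1, 0]"] assms[of "vector [0, 1]"]
  by (simp add: vec_eq_iff forall_2 wedge_def)

lemma exists_wedge_nonzero: "y \<noteq> 0 \<Longrightarrow> \<exists>v. wedge v y \<noteq> 0"
  using wedge_ext[of y 0] by (auto simp: wedge_simps)

lemma linear_iff_wedge:
  "Vector_Spaces.linear (*s) (*) f \<longleftrightarrow> (\<exists>w. f = (\<lambda>v. wedge v w))"
proof
  assume "Vector_Spaces.linear (*s) (*) f"
  then have f: "f (x + y) = f x + f y" "f (c *s x) = c * f x" for x y c
    by (auto simp: Vector_Spaces.linear_iff)
  have "f v = wedge v (vector [- f (axis 2 1), f (axis 1 1)])" for v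
  proof -
    have "v = v $ 1 *s axis 1 1 + v $ 2 *s axis 2 1"
      by (simp add: vec_eq_iff forall_2 axis_def)
    then have "f v = v $ 1 * f (axis 1 1) + v $ 2 * f (axis 2 1)"
      using f by metis
    then show ?thesis by (simp add: wedge_def)
  qed
  then show "\<exists>w. f = (\<lambda>v. wedge v w)" by blast
next
  \<comment> \<open>The predicate for linearity includes the vector space axioms of both scalar
    multiplications.\<close>
  have "vector_space ((*) :: complex \<Rightarrow> complex \<Rightarrow> complex)"
    by unfold_locales (auto simp: algebra_simps)
  moreover have "vector_space ((*s) :: complex \<Rightarrow> complex^2 \<Rightarrow> complex^2)"
    by unfold_locales (auto simp: vec_eq_iff algebra_simps)
  ultimately show "\<exists>w. f = (\<lambda>v. wedge v w) \<Longrightarrow> Vector_Spaces.linear (*s) (*) f"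
    by (auto simp: Vector_Spaces.linear_iff wedge_simps)
qed

lemma scaleR_eq_smult: "r *\<^sub>R v = complex_of_real r *s (v :: complex^'n)"
  by (simp add: vec_eq_iff scaleR_conv_of_real[where 'a = complex])

lemma cmod_wedge_le: "cmod (wedge v w) \<le> 2 * norm w * norm v"
proof -
  have "cmod (wedge v w) \<le> cmod (v $ 1) * cmod (w $ 2) + cmod (v $ 2) * cmod (w $ 1)"
    unfolding wedge_def by (metis norm_triangle_ineq4 norm_mult)
  also have "\<dots> \<le> norm v * norm w + norm v * norm w"
    by (intro add_mono[OF mult_mono mult_mono] Finite_Cartesian_Product.norm_nth_le)
      (auto simp: Finite_Cartesian_Product.norm_nth_le)
  finally show ?thesis by (simp add: mult_ac)
qed

section \<open>Complex norms on the plane and their comparison with the Euclidean norm\<close>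

locale planar_norm =
  fixes N :: "complex^2 \<Rightarrow> real"
  assumes complex_norm: "complex_norm N"
begin

lemma N_zero [simp]: "N 0 = 0"
  using complex_norm unfolding complex_norm_def by blast

lemma N_zero_iff [simp]: "N x = 0 \<longleftrightarrow> x = 0"
  and N_scale [simp]: "N (c *s x) = cmod c * N x"
  and N_triangle: "N (x + y) \<le> N x + N y"
  using complex_norm unfolding complex_norm_def by blast+

lemma N_scaleR [simp]: "N (r *\<^sub>R x) = \<bar>r\<bar> * N x"
  by (simp add: scaleR_eq_smult)

lemma N_minus [simp]: "N (- x) = N x"
  using N_scaleR[of "-1" x] by simp

lemma N_nonneg [simp]: "0 \<le> N x"
  using N_triangle[of x "- x"] by simp

lemma N_pos: "x \<noteq> 0 \<Longrightarrow> 0 < N x"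
  by (simp add: less_le)

lemma convex_on_N: "convex_on UNIV N"
  by (rule convex_onI) (auto intro: order_trans[OF N_triangle])

lemma continuous_on_N: "continuous_on A N"
  using convex_on_continuous[OF open_UNIV convex_on_N] continuous_on_subset by blast

text \<open>By compactness \<open>N\<close> attains a positive minimum on the Euclidean unit sphere;
  homogeneity does the rest.\<close>

lemma norm_le_N:
  obtains m where "0 < m" "\<And>v. m * norm v \<le> N v"
proof -
  have "sphere (0 :: complex^2) 1 \<noteq> {}" by simp
  then obtain u where u: "u \<in> sphere 0 1" "\<And>v. v \<in> sphere 0 1 \<Longrightarrow> N u \<le> N v"
    using continuous_attains_inf[OF compact_sphere _ continuous_on_N] by metis
  have "N u * norm v \<le> N v" for v
  proof (cases "v = 0")
    case False
    have "N u \<le> N (inverse (norm v) *\<^sub>R v)" using False by (intro u(2)) simp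
    then show ?thesis using False by (simp add: field_simps)
  qed simp
  moreover have "0 < N u" using u(1) by (intro N_pos) auto
  ultimately show ?thesis using that by blast
qed

lemma cmod_wedge_bounded: "\<exists>K. \<forall>v. cmod (wedge v w) \<le> K * N v"
proof -
  obtain m where m: "0 < m" "\<And>v. m * norm v \<le> N v" using norm_le_N by blast
  have "cmod (wedge v w) \<le> (2 * norm w / m) * N v" for v
  proof -
    have "cmod (wedge v w) \<le> (2 * norm w / m) * (m * norm v)"
      using cmod_wedge_le[of v w] m(1) by simp
    also have "\<dots> \<le> (2 * norm w / m) * N v"
      using m by (intro mult_left_mono) auto
    finally show ?thesis .
  qed
  then show ?thesis by blast
qed

lemma closed_N_ball: "closed {x. N x \<le> 1}"
  by (intro closed_Collect_le continuous_on_N continuous_intros)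

lemma convex_N_ball: "convex {x. N x \<le> 1}"
  by (intro convexI) (auto intro!: order_trans[OF N_triangle] convex_bound_le)

text \<open>The right-hand side says that the functional \<open>wedge _ y\<close> attains its norm
  at \<open>x\<close>. For independent \<open>x\<close> and \<open>y\<close>, every vector off the
  line of \<open>y\<close> is a multiple of some \<open>x + c *s y\<close>, and the functional is
  constant on these points, so minimality of \<open>N\<close> at \<open>x\<close> amounts to
  this.\<close>

lemma BJ_orthogonal_iff:
  "BJ_orthogonal N x y \<longleftrightarrow> (\<forall>v. cmod (wedge v y) * N x \<le> cmod (wedge x y) * N v)"
proof (cases "x = 0 \<or> y = 0")
  case True
  then show ?thesis by (auto simp: BJ_orthogonal_def wedge_simps)
next
  case False
  then have x: "x \<noteq> 0" and y: "y \<noteq> 0" by auto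
  show ?thesis
  proof
    assume o: "BJ_orthogonal N x y"
    have d: "wedge x y \<noteq> 0"
    proof
      assume "wedge x y = 0"
      then obtain c where "x = c *s y"
        using wedge_eq_0_iff[OF y, of x] wedge_swap[of x y] by auto
      then show False using o[unfolded BJ_orthogonal_def, rule_format, of "- c"] N_pos[OF x] by simp
    qed
    show "\<forall>v. cmod (wedge v y) * N x \<le> cmod (wedge x y) * N v"
    proof
      fix v
      show "cmod (wedge v y) * N x \<le> cmod (wedge x y) * N v"
      proof (cases "wedge v y = 0")
        case False
        \<comment> \<open>The coefficient comes from Cramer's rule: it makes
          \<open>x + c *s y\<close> a multiple of \<open>v\<close>.\<close>
        have "cmod (wedge v y) * N x
            \<le> cmod (wedge v y) * N (x + (wedge x v / wedge v y) *s y)"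
          using o by (intro mult_left_mono) (auto simp: BJ_orthogonal_def)
        also have "\<dots> = N (wedge v y *s (x + (wedge x v / wedge v y) *s y))"
          by (simp only: N_scale)
        also have "wedge v y *s (x + (wedge x v / wedge v y) *s y) = wedge x y *s v"
          using False by (simp add: wedge_cramer[of x y v] vec_eq_iff distrib_left)
        finally show ?thesis by simp
      qed simp
    qed
  next
    assume o: "\<forall>v. cmod (wedge v y) * N x \<le> cmod (wedge x y) * N v"
    obtain v where v: "wedge v y \<noteq> 0" using exists_wedge_nonzero[OF y] by blast
    have "0 < cmod (wedge v y) * N x" using v N_pos[OF x] by simp
    with o[rule_format, of v] have d: "wedge x y \<noteq> 0" by auto
    show "BJ_orthogonal N x y"
      unfolding BJ_orthogonal_def
    proof
      fix c
      show "N x \<le> N (x + c *s y)"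
        using o[rule_format, of "x + c *s y"] d by (simp add: wedge_simps)
    qed
  qed
qed

lemma BJ_scale: "BJ_orthogonal N x y \<Longrightarrow> BJ_orthogonal N (a *s x) (b *s y)"
  unfolding BJ_orthogonal_iff
proof
  fix v
  assume "\<forall>v. cmod (wedge v y) * N x \<le> cmod (wedge x y) * N v"
  then have "(cmod a * cmod b) * (cmod (wedge v y) * N x)
      \<le> (cmod a * cmod b) * (cmod (wedge x y) * N v)"
    by (intro mult_left_mono) auto
  then show "cmod (wedge v (b *s y)) * N (a *s x) \<le> cmod (wedge (a *s x) (b *s y)) * N v"
    by (simp add: wedge_simps norm_mult mult_ac)
qed

lemma BJ_scale_iff:
  assumes "a \<noteq> 0" "b \<noteq> 0"
  shows "BJ_orthogonal N (a *s x) (b *s y) \<longleftrightarrow> BJ_orthogonal N x y"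
  using BJ_scale[of "a *s x" "b *s y" "inverse a" "inverse b"] BJ_scale[of x y a b] assms
  by auto

lemma BJ_zero [simp]: "BJ_orthogonal N 0 y" "BJ_orthogonal N x 0"
  by (simp_all add: BJ_orthogonal_def)

lemma wedge_nonzero_if_BJ:
  assumes "BJ_orthogonal N x y" "x \<noteq> 0" "y \<noteq> 0"
  shows "wedge x y \<noteq> 0"
proof
  assume "wedge x y = 0"
  moreover obtain v where "wedge v y \<noteq> 0" using exists_wedge_nonzero[OF assms(3)] by blast
  ultimately show False
    using assms(1)[unfolded BJ_orthogonal_iff, rule_format, of v] N_pos[OF assms(2)]
    by (simp add: mult_le_0_iff)
qed

lemma BJ_refl_iff: "BJ_orthogonal N x x \<longleftrightarrow> x = 0"
  using wedge_nonzero_if_BJ[of x x] by (auto simp: wedge_simps)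

section \<open>Supporting functionals represented by vectors\<close>

definition norming :: "complex^2 \<Rightarrow> complex^2 \<Rightarrow> bool" where
  "norming x w \<longleftrightarrow> wedge x w = of_real (N x) \<and> (\<forall>v. cmod (wedge v w) \<le> N v)"

lemma norming_imp_BJ: "norming x w \<Longrightarrow> BJ_orthogonal N x w"
  unfolding norming_def BJ_orthogonal_iff by (simp add: mult_left_mono mult.commute[of _ "N x"])

lemma norming_imp_nonzero: "norming x w \<Longrightarrow> x \<noteq> 0 \<Longrightarrow> w \<noteq> 0"
  unfolding norming_def by (auto simp: wedge_simps)

text \<open>By \<open>BJ_orthogonal_iff\<close> the functional of \<open>y\<close> attains its norm
  at \<open>x\<close>; the factor scales its value there to \<open>N x\<close>.\<close>

lemma BJ_imp_norming:
  assumes "BJ_orthogonal N x y" "x \<noteq> 0" "y \<noteq> 0"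
  shows "norming x ((of_real (N x) / wedge x y) *s y)"
proof -
  have d: "wedge x y \<noteq> 0" using assms by (rule wedge_nonzero_if_BJ)
  then show ?thesis
    using assms(1) unfolding norming_def BJ_orthogonal_iff
    by (auto simp: wedge_simps norm_mult norm_divide field_simps)
qed

lemma supporting_functional_iff:
  assumes "x \<noteq> 0"
  shows "supporting_functional N x f \<longleftrightarrow> (\<exists>w. norming x w \<and> f = (\<lambda>v. wedge v w))"
proof -
  have "dual_norm N (\<lambda>v. wedge v w) = 1 \<longleftrightarrow> (\<forall>v. cmod (wedge v w) \<le> N v)"
    if w: "wedge x w = of_real (N x)" for w
  proof -
    \<comment> \<open>The supremum in \<open>dual_norm\<close> controls the individual values only
      once the set is known to be bounded.\<close>
    obtain K where K: "\<And>v. cmod (wedge v w) \<le> K * N v" using cmod_wedge_bounded by blast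
    have bdd: "bdd_above ((\<lambda>v. cmod (wedge v w)) ` {v. N v \<le> 1})"
    proof (rule bdd_aboveI2)
      fix v assume "v \<in> {v. N v \<le> 1}"
      then have "\<bar>K\<bar> * N v \<le> \<bar>K\<bar>" by (simp add: mult_left_le)
      moreover have "K * N v \<le> \<bar>K\<bar> * N v" by (simp add: mult_right_mono)
      ultimately show "cmod (wedge v w) \<le> \<bar>K\<bar>" using K[of v] by linarith
    qed
    show ?thesis
    proof
      assume d: "dual_norm N (\<lambda>v. wedge v w) = 1"
      have le: "cmod (wedge v w) \<le> 1" if "N v \<le> 1" for v
        using cSUP_upper[OF _ bdd, of v] that d unfolding dual_norm_def by simp
      show "\<forall>v. cmod (wedge v w) \<le> N v"
      proof
        fix v
        show "cmod (wedge v w) \<le> N v"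
        proof (cases "v = 0")
          case False
          then show ?thesis
            using le[of "inverse (N v) *\<^sub>R v"] N_pos[OF False]
            by (simp add: wedge_simps norm_mult norm_divide norm_inverse field_simps)
        qed (simp add: wedge_simps)
      qed
    next
      assume le: "\<forall>v. cmod (wedge v w) \<le> N v"
      have "inverse (N x) *\<^sub>R x \<in> {v. N v \<le> 1}" using assms by simp
      moreover have "cmod (wedge (inverse (N x) *\<^sub>R x) w) = 1"
        using assms by (simp add: wedge_simps norm_mult norm_inverse w)
      ultimately have "1 \<le> dual_norm N (\<lambda>v. wedge v w)"
        unfolding dual_norm_def using cSUP_upper[OF _ bdd] by metis
      moreover have "dual_norm N (\<lambda>v. wedge v w) \<le> 1"
        unfolding dual_norm_def
        using le by (intro cSUP_least) (auto intro: order_trans exI[of _ 0])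
      ultimately show "dual_norm N (\<lambda>v. wedge v w) = 1" by simp
    qed
  qed
  then show ?thesis
    unfolding supporting_functional_def norming_def linear_iff_wedge by auto
qed

lemma smooth_vector_iff: "smooth_vector N x \<longleftrightarrow> x \<noteq> 0 \<and> (\<exists>!w. norming x w)"
proof (cases "x = 0")
  case False
  have inj: "(\<lambda>v. wedge v w) = (\<lambda>v. wedge v w') \<longleftrightarrow> w = w'" for w w'
    using wedge_ext by metis
  show ?thesis
    unfolding smooth_vector_def supporting_functional_iff[OF False]
  proof (intro conj_cong refl iffI)
    assume f: "\<exists>!f. \<exists>w. norming x w \<and> f = (\<lambda>v. wedge v w)"
    then obtain w where w: "norming x w" by blast
    have "w' = w" if "norming x w'" for w'
      using f w that inj[of w' w] by blast
    then show "\<exists>!w. norming x w" using w by blast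
  next
    assume "\<exists>!w. norming x w"
    then show "\<exists>!f. \<exists>w. norming x w \<and> f = (\<lambda>v. wedge v w)" by auto
  qed
qed (simp add: smooth_vector_def)

text \<open>Take a point of least norm on the complex line through \<open>w\<close> in direction
  \<open>x\<close>: minimality is orthogonality to \<open>x\<close>, and independence of
  \<open>w\<close> and \<open>x\<close> keeps the point nonzero.\<close>

lemma exists_BJ_left:
  assumes "x \<noteq> 0"
  shows "\<exists>y. y \<noteq> 0 \<and> BJ_orthogonal N y x"
proof -
  obtain w where w: "wedge w x \<noteq> 0" using exists_wedge_nonzero[OF assms] by blast
  \<comment> \<open>Outside the disc of this radius \<open>N (w + c *s x)\<close> exceeds
    \<open>N w\<close>, so a minimum over the disc is global.\<close>
  define r where "r = 2 * N w / N x"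
  have r: "0 \<le> r" by (simp add: r_def)
  have cont: "continuous_on A (\<lambda>c. N (w + c *s x))" for A
  proof (rule continuous_on_compose2[OF continuous_on_N[of UNIV]])
    show "continuous_on A (\<lambda>c. w + c *s x)"
      unfolding vector_scalar_mult_def by (intro continuous_intros)
  qed simp
  obtain c where c: "c \<in> cball 0 r" "\<And>d. d \<in> cball 0 r \<Longrightarrow> N (w + c *s x) \<le> N (w + d *s x)"
    using continuous_attains_inf[OF compact_cball _ cont, of 0 r] r by auto
  have min: "N (w + c *s x) \<le> N (w + d *s x)" for d
  proof (cases "cmod d \<le> r")
    case False
    then have "2 * N w < cmod d * N x" using N_pos[OF assms] by (simp add: r_def field_simps)
    also have "\<dots> = N ((w + d *s x) + - w)" by simp
    also have "\<dots> \<le> N (w + d *s x) + N w" using N_triangle[of "w + d *s x" "- w"] by simp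
    finally have "N w < N (w + d *s x)" by simp
    moreover have "N (w + c *s x) \<le> N w" using c(2)[of 0] r by simp
    ultimately show ?thesis by simp
  qed (use c in simp)
  have "wedge (w + c *s x) x \<noteq> 0" using w by (simp add: wedge_simps)
  then have "w + c *s x \<noteq> 0" using wedge_simps(9) by metis
  moreover have "BJ_orthogonal N (w + c *s x) x"
    unfolding BJ_orthogonal_def using min by (metis add.assoc vector_sadd_rdistrib)
  ultimately show ?thesis by blast
qed

text \<open>\<open>ball_face\<close> tests only segments with endpoints on the unit sphere. A
  segment in the ball with an inner point on the sphere has both endpoints there, so the condition
  extends to the whole ball.\<close>

lemma ball_face_imp_face_of:
  assumes "ball_face N F"
  shows "F face_of {x. N x \<le> 1}"
  unfolding face_of_def
proof (intro conjI ballI impI)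
  show "F \<subseteq> {x. N x \<le> 1}" "convex F" using assms by (auto simp: ball_face_def)
next
  fix a b x
  assume a: "a \<in> {x. N x \<le> 1}" and b: "b \<in> {x. N x \<le> 1}" and x: "x \<in> F" "x \<in> open_segment a b"
  obtain u where u: "0 < u" "u < 1" "x = (1 - u) *\<^sub>R a + u *\<^sub>R b" and ab: "a \<noteq> b"
    using x(2) by (auto simp: in_segment)
  have "1 = N x" using assms x(1) by (auto simp: ball_face_def)
  also have "\<dots> \<le> (1 - u) * N a + u * N b"
    using N_triangle[of "(1 - u) *\<^sub>R a" "u *\<^sub>R b"] u by simp
  finally have le: "1 \<le> (1 - u) * N a + u * N b" .
  have "u * N b \<le> u" "(1 - u) * N a \<le> 1 - u"
    using u a b by (auto intro: mult_left_le)
  then have "u * N b = u" "(1 - u) * N a = 1 - u" using le by linarith+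
  then have "N a = 1" "N b = 1" using u by auto
  then show "a \<in> F" "b \<in> F" using assms x ab unfolding ball_face_def by blast+
qed

text \<open>Closedness places the points of \<open>rel_frontier F\<close> in \<open>F\<close>
  itself.\<close>

lemma closed_ball_face: "ball_face N F \<Longrightarrow> closed F"
  using face_of_imp_closed[OF convex_N_ball closed_N_ball] ball_face_imp_face_of by blast

end

section \<open>Faces and neighbourhoods\<close>

lemma wedge_eqI:
  assumes "wedge x z \<noteq> 0" "wedge x w = wedge x w'" "wedge z w = wedge z w'"
  shows "w = w'"
proof (rule wedge_ext)
  fix v
  have "wedge x z * wedge v w = wedge v z * wedge x w + wedge x v * wedge z w" for w
    by (metis wedge_cramer wedge_simps(1) wedge_simps(5))
  then show "wedge v w = wedge v w'" using assms by (metis mult_cancel_left)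
qed

text \<open>The number 1 is an extreme point of the closed unit disc: comparing real parts gives
  \<open>Re a = 1\<close>, and then the modulus bound leaves no imaginary part.\<close>

lemma eq_1_if_convex_combination_eq_1:
  fixes a b :: complex
  assumes "cmod a \<le> 1" "cmod b \<le> 1" "0 < u" "u < 1" "of_real (1 - u) * a + of_real u * b = 1"
  shows "a = 1"
proof -
  have "(1 - u) * Re a + u * Re b = 1" using arg_cong[OF assms(5), of Re] by simp
  moreover have "Re a \<le> 1" "Re b \<le> 1"
    using assms(1,2) complex_Re_le_cmod order_trans by blast+
  moreover have "u * Re b \<le> u" using assms(3) \<open>Re b \<le> 1\<close> by simp
  ultimately have "(1 - u) * 1 \<le> (1 - u) * Re a" by simp
  then have "Re a = 1" using assms(4) \<open>Re a \<le> 1\<close> mult_le_cancel_left_pos[of "1 - u" 1 "Re a"] by simp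
  moreover have "(Re a)\<^sup>2 + (Im a)\<^sup>2 \<le> 1"
    using assms(1) by (metis cmod_power2 norm_ge_zero power_le_one)
  ultimately show ?thesis by (simp add: complex_eq_iff)
qed

context planar_norm
begin

abbreviation perp (infix "\<perp>" 50) where "x \<perp> y \<equiv> BJ_orthogonal N x y"

text \<open>The inclusion in one direction suffices, since \<open>x\<close> and \<open>x'\<close>
  may be exchanged.\<close>

definition nbhd_determined :: bool where
  "nbhd_determined \<longleftrightarrow> (\<forall>x x' y. x \<noteq> 0 \<and> x' \<noteq> 0 \<and> y \<noteq> 0 \<and> x \<perp> y \<and> x' \<perp> y \<longrightarrow> (\<forall>w. x \<perp> w \<longrightarrow> x' \<perp> w))"

text \<open>The functional has modulus at most 1 at both endpoints and equals 1 at an inner point;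
  extremality of 1 in the disc forces both end values.\<close>

lemma norming_segment:
  assumes "norming p w" "N p = 1" "p = (1 - u) *\<^sub>R a + u *\<^sub>R b" "0 < u" "u < 1"
    "N a \<le> 1" "N b \<le> 1"
  shows "wedge a w = 1 \<and> wedge b w = 1"
proof -
  have le: "cmod (wedge a w) \<le> 1" "cmod (wedge b w) \<le> 1"
    using assms order_trans unfolding norming_def by blast+
  have "wedge p w = 1" using assms(1,2) by (simp add: norming_def)
  then have eq: "of_real (1 - u) * wedge a w + of_real u * wedge b w = 1"
    by (simp only: assms(3) wedge_simps)
  have "wedge a w = 1"
    by (rule eq_1_if_convex_combination_eq_1[OF le assms(4,5) eq])
  moreover have "wedge b w = 1"
    by (rule eq_1_if_convex_combination_eq_1[OF le(2,1), of "1 - u"])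
      (use assms(4,5) eq in \<open>simp_all add: add.commute\<close>)
  ultimately show ?thesis ..
qed

text \<open>Let \<open>m\<close> be the midpoint of \<open>x\<close> and another point
  \<open>z\<close> of the face. A functional supporting \<open>m\<close> is 1 at \<open>x\<close>
  and \<open>z\<close>, hence supports \<open>x\<close>, so \<open>nbhd_determined\<close> applies
  to \<open>x\<close> and \<open>m\<close>. Any functional supporting \<open>x\<close> is thus, up
  to scaling, one supporting \<open>m\<close>, and therefore is 1 at \<open>z\<close> as well; its
  values at the independent vectors \<open>x\<close> and \<open>z\<close> determine it.\<close>

lemma face_boundaries_smooth_if_nbhd_determined:
  assumes det: nbhd_determined and mate: "\<And>x. x \<noteq> 0 \<Longrightarrow> \<exists>y. y \<noteq> 0 \<and> x \<perp> y"
  shows "face_boundaries_smooth N"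
  unfolding face_boundaries_smooth_def
proof (intro allI impI ballI, elim conjE)
  fix F x
  assume F: "ball_face N F" and dim: "aff_dim F \<noteq> 0" and "x \<in> rel_frontier F"
  then have x: "x \<in> F" using closed_ball_face[OF F] by (simp add: rel_frontier_def)
  have "F \<noteq> {x}" using dim by auto
  then obtain z where z: "z \<in> F" "z \<noteq> x" using x by blast
  have N1: "N v = 1" if "v \<in> F" for v using F that by (auto simp: ball_face_def)
  define m where "m = (1 - 1 / 2 :: real) *\<^sub>R x + (1 / 2 :: real) *\<^sub>R z"
  have "convex F" using F by (simp add: ball_face_def)
  then have "m \<in> F" unfolding m_def by (rule convexD_alt) (use x z in auto)
  have nz: "x \<noteq> 0" "m \<noteq> 0" using N1[OF x] N1[OF \<open>m \<in> F\<close>] by auto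
  have mid: "wedge x w = 1 \<and> wedge z w = 1" if "norming m w" for w
    by (rule norming_segment[OF that N1[OF \<open>m \<in> F\<close>] m_def]) (use N1 x z in auto)
  obtain y where y: "y \<noteq> 0" "m \<perp> y" using mate[OF nz(2)] by blast
  define w0 where "w0 = (of_real (N m) / wedge m y) *s y"
  have w0: "norming m w0" unfolding w0_def using y nz(2) by (intro BJ_imp_norming)
  then have xz0: "wedge x w0 = 1" "wedge z w0 = 1" using mid by blast+
  then have "norming x w0" using w0 N1[OF x] by (simp add: norming_def)
  have one: "wedge x w = 1 \<and> wedge z w = 1" if w: "norming x w" for w
  proof -
    have "m \<perp> w"
      using det[unfolded nbhd_determined_def] nz norming_imp_BJ[OF \<open>norming x w0\<close>]
        norming_imp_nonzero[OF w0 nz(2)] norming_imp_BJ[OF w0] norming_imp_BJ[OF w] by blast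
    then have "norming m ((of_real (N m) / wedge m w) *s w)"
      using nz(2) norming_imp_nonzero[OF w nz(1)] by (intro BJ_imp_norming)
    from mid[OF this] have "(of_real (N m) / wedge m w) * wedge x w = 1"
      "(of_real (N m) / wedge m w) * wedge z w = 1"
      by (simp_all only: wedge_simps)
    moreover have "wedge x w = 1" using w N1[OF x] by (simp add: norming_def)
    ultimately show ?thesis by simp
  qed
  have "wedge x z \<noteq> 0"
  proof
    assume "wedge x z = 0"
    then obtain c where "z = c *s x" using wedge_eq_0_iff[OF nz(1)] by blast
    then show False using xz0 z(2) by (simp add: wedge_simps)
  qed
  then have "w = w'" if "norming x w" "norming x w'" for w w'
    using one[OF that(1)] one[OF that(2)] wedge_eqI[of x z w w'] by simp
  then show "smooth_vector N x"
    using smooth_vector_iff nz(1) \<open>norming x w0\<close> by blast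
qed

text \<open>
  The unit vectors orthogonal to \<open>x\<close>, normalised by a functional vanishing at \<open>x\<close>, form a face \<open>F\<close>. A
  point in its relative interior is smooth because its supporting functionals are constant
  on \<open>F\<close>, and \<open>F\<close> contains two independent vectors.
\<close>

lemma perp_unique_if_face_boundaries_smooth:
  assumes smooth: "face_boundaries_smooth N"
    and "x \<noteq> 0" "y \<perp> x" "y' \<perp> x" "wedge y y' \<noteq> 0" "y \<perp> w"
  shows "wedge x w = 0"
proof (cases "w = 0")
  case False
  have y0: "y \<noteq> 0" "y' \<noteq> 0" using assms(5) by (auto simp: wedge_simps)
  \<comment> \<open>The functional of this multiple of \<open>x\<close> supports \<open>y\<close>
    and vanishes at \<open>x\<close>. The goal is reached by showing that \<open>w\<close> is a
    multiple of \<open>w0\<close>.\<close>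
  define w0 where "w0 = (of_real (N y) / wedge y x) *s x"
  have w0: "norming y w0" unfolding w0_def using assms y0 by (intro BJ_imp_norming)
  define F where "F = {v. N v \<le> 1 \<and> wedge v w0 = 1}"
  have le: "cmod (wedge v w0) \<le> N v" for v using w0 by (simp add: norming_def)
  have F1: "N v = 1" if "v \<in> F" for v using le[of v] that by (simp add: F_def)
  have Fn: "norming v w0" if "v \<in> F" for v
    using that F1[OF that] w0 by (simp add: F_def norming_def)
  have face: "ball_face N F"
    unfolding ball_face_def
  proof (intro conjI allI impI)
    have "F = {v. N v \<le> 1} \<inter> {v. wedge v w0 = 1}" by (auto simp: F_def)
    moreover have "convex {v. wedge v w0 = 1}"
      by (intro convexI) (simp add: wedge_simps flip: of_real_add)
    ultimately show "convex F" using convex_N_ball convex_Int by metis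
    show "F \<subseteq> {v. N v = 1}" using F1 by blast
  next
    fix a b assume ab: "N a = 1 \<and> N b = 1 \<and> a \<noteq> b \<and> open_segment a b \<inter> F \<noteq> {}"
    then obtain p where "p \<in> F" "p \<in> open_segment a b" by blast
    then obtain u where p: "p \<in> F" "p = (1 - u) *\<^sub>R a + u *\<^sub>R b" "0 < u" "u < 1"
      by (auto simp: in_segment)
    have "wedge a w0 = 1 \<and> wedge b w0 = 1"
      by (rule norming_segment[OF Fn[OF p(1)] F1[OF p(1)] p(2-4)]) (use ab in auto)
    then show "a \<in> F" "b \<in> F" using ab by (auto simp: F_def)
  qed
  define p where "p = (1 / of_real (N y)) *s y"
  define p' where "p' = (1 / wedge y' w0) *s y'"
  have pF: "p \<in> F"
    using y0 w0 by (simp add: F_def p_def wedge_simps norming_def norm_divide)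
  have "y' \<perp> w0" using BJ_scale[OF assms(4), of 1] by (simp add: w0_def)
  moreover have "w0 \<noteq> 0" using w0 y0 norming_imp_nonzero by blast
  ultimately have "wedge y' w0 \<noteq> 0" using y0 by (intro wedge_nonzero_if_BJ)
  \<comment> \<open>The functional of \<open>w0\<close> attains its norm at \<open>y'\<close> too,
    so the rescaled vector \<open>p'\<close> stays in the unit ball.\<close>
  moreover have "N y' \<le> cmod (wedge y' w0)"
    using \<open>y' \<perp> w0\<close>[unfolded BJ_orthogonal_iff, rule_format, of y] w0 N_pos[OF y0(1)]
    by (simp add: norming_def mult.commute)
  ultimately have p'F: "p' \<in> F"
    by (simp add: F_def p'_def wedge_simps norm_divide)
  have indep: "wedge p p' \<noteq> 0"
    using assms(5) y0 \<open>wedge y' w0 \<noteq> 0\<close> by (simp add: p_def p'_def wedge_simps)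
  have "p \<perp> w" using BJ_scale[OF assms(6), of _ 1] by (simp add: p_def)
  moreover have p0: "p \<noteq> 0" using F1[OF pF] by auto
  ultimately have "norming p ((of_real (N p) / wedge p w) *s w)"
    using False by (intro BJ_imp_norming)
  then obtain k where k: "norming p (k *s w)" by blast
  have "p \<in> rel_interior F \<or> p \<in> rel_frontier F"
    using pF closure_subset by (auto simp: rel_frontier_def)
  then have "k *s w = w0"
  proof
    assume "p \<in> rel_frontier F"
    moreover have "aff_dim F \<noteq> 0"
      using pF p'F indep by (auto simp: aff_dim_eq_0 wedge_simps)
    ultimately have "smooth_vector N p"
      using smooth face by (auto simp: face_boundaries_smooth_def)
    then show ?thesis using k Fn[OF pF] by (auto simp: smooth_vector_iff)
  next
    assume "p \<in> rel_interior F"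
    moreover have "convex F" using face by (simp add: ball_face_def)
    \<comment> \<open>From a relative interior point the segment from \<open>p'\<close> to
      \<open>p\<close> can be prolonged beyond \<open>p\<close> inside \<open>F\<close>. Thus
      \<open>p\<close> lies strictly inside a segment of \<open>F\<close> ending at
      \<open>p'\<close>, and every functional supporting \<open>p\<close> is 1 at
      \<open>p'\<close>.\<close>
    ultimately obtain e where e: "e > 1" "(1 - e) *\<^sub>R p' + e *\<^sub>R p \<in> F"
      using convex_rel_interior_if2 p'F hull_inc by metis
    have comb: "p = (1 - 1 / e) *\<^sub>R p' + (1 / e) *\<^sub>R ((1 - e) *\<^sub>R p' + e *\<^sub>R p)"
      using e(1) by (simp add: algebra_simps)
    have "wedge p' (k *s w) = 1"
      using norming_segment[OF k F1[OF pF] comb] e F1 p'F by simp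
    moreover have "wedge p (k *s w) = 1" using k F1[OF pF] by (simp add: norming_def)
    ultimately show ?thesis
      using pF p'F by (intro wedge_eqI[OF indep]) (simp_all add: F_def)
  qed
  moreover have "wedge x w0 = 0" by (simp add: w0_def wedge_simps)
  ultimately have "k * wedge x w = 0" "k \<noteq> 0"
    using \<open>w0 \<noteq> 0\<close> by (auto simp: wedge_simps)
  then show ?thesis by simp
qed (simp add: wedge_simps)

text \<open>If \<open>x\<close> and \<open>x'\<close> are dependent, orthogonality passes from one
  to the other by scaling. If they are independent, both are orthogonal to \<open>y\<close>, and the
  previous lemma confines every vector to which \<open>x\<close> is orthogonal to the line of
  \<open>y\<close>.\<close>

lemma nbhd_determined_if_face_boundaries_smooth:
  assumes "face_boundaries_smooth N"
  shows nbhd_determined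
  unfolding nbhd_determined_def
proof (intro allI impI, elim conjE)
  fix x x' y w
  assume a: "x \<noteq> 0" "x' \<noteq> 0" "y \<noteq> 0" "x \<perp> y" "x' \<perp> y" "x \<perp> w"
  show "x' \<perp> w"
  proof (cases "wedge x x' = 0")
    case True
    then obtain c where "x' = c *s x" using wedge_eq_0_iff a(1) by blast
    then show ?thesis using BJ_scale[OF a(6), of c 1] by simp
  next
    case False
    then have "wedge y w = 0"
      using perp_unique_if_face_boundaries_smooth assms a by blast
    then obtain c where "w = c *s y" using wedge_eq_0_iff a(3) by blast
    then show ?thesis using BJ_scale[OF a(5), of 1 c] by simp
  qed
qed

end

section \<open>The orthogonality graph\<close>

lemma out_perp_eq_Image: "out_perp N x = Gamma0 N `` {x}"
  by (auto simp: out_perp_def)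

lemma complex2_lepoll_real: "(UNIV :: (complex^2) set) \<lesssim> (UNIV :: real set)"
proof -
  let ?R = "UNIV :: real set"
  have inf: "infinite ?R" by (rule infinite_UNIV_char_0)
  have "inj (\<lambda>v :: complex^2. ((Re (v $ 1), Im (v $ 1)), (Re (v $ 2), Im (v $ 2))))"
    by (rule injI) (simp add: vec_eq_iff forall_2 complex_eq_iff)
  then have "(UNIV :: (complex^2) set) \<lesssim> (?R \<times> ?R) \<times> (?R \<times> ?R)"
    unfolding lepoll_def by auto
  also have "(?R \<times> ?R) \<times> (?R \<times> ?R) \<approx> ?R \<times> ?R"
    using infinite_times_self_eqpoll[OF inf] by (intro times_eqpoll_cong)
  also have "?R \<times> ?R \<approx> ?R" by (rule infinite_times_self_eqpoll[OF inf])
  finally show ?thesis .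
qed

context planar_norm
begin

lemma biclique_graph_Gamma0:
  assumes sym: "\<forall>x y. x \<perp> y \<longrightarrow> y \<perp> x"
    and det: nbhd_determined
    and continuum: "range (out_perp N) \<approx> (UNIV :: real set)"
  shows "biclique_graph (Gamma0 N) 0"
proof
  fix x y :: "complex^2"
  show "(x, y) \<in> Gamma0 N \<Longrightarrow> (y, x) \<in> Gamma0 N"
    using sym by (simp add: Gamma0_def)
  show "(0, x) \<in> Gamma0 N" by (simp add: Gamma0_def)
  show "range (\<lambda>x. Gamma0 N `` {x}) \<approx> (UNIV :: real set)"
    using continuum by (simp add: out_perp_eq_Image[abs_def])
  assume x: "x \<noteq> 0"
  then show "(x, x) \<notin> Gamma0 N" by (simp add: Gamma0_def BJ_refl_iff)
  show "\<exists>y. y \<noteq> 0 \<and> (x, y) \<in> Gamma0 N"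
    using exists_BJ_left[OF x] sym by (auto simp: Gamma0_def)
  show "{x'. Gamma0 N `` {x'} = Gamma0 N `` {x}} \<approx> (UNIV :: real set)"
  proof (rule lepoll_antisym)
    show "{x'. Gamma0 N `` {x'} = Gamma0 N `` {x}} \<lesssim> (UNIV :: real set)"
      by (rule lepoll_trans[OF subset_imp_lepoll[OF subset_UNIV] complex2_lepoll_real])
    \<comment> \<open>The scalars \<open>Complex 1 t\<close> form a real-parameter family of
      distinct nonzero numbers, giving continuum many vectors with the neighbourhood of
      \<open>x\<close>.\<close>
    have "Complex 1 t *s x \<perp> w \<longleftrightarrow> x \<perp> w" for t w
    proof -
      have "Complex 1 t \<noteq> 0" by (simp add: complex_eq_iff)
      then show ?thesis using BJ_scale_iff[of "Complex 1 t" 1 x w] by simp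
    qed
    then have "Gamma0 N `` {Complex 1 t *s x} = Gamma0 N `` {x}" for t
      by (simp add: Gamma0_def)
    moreover have "inj (\<lambda>t. Complex 1 t *s x)"
      using x by (intro injI) (simp add: vector_mul_rcancel)
    ultimately show "(UNIV :: real set) \<lesssim> {x'. Gamma0 N `` {x'} = Gamma0 N `` {x}}"
      unfolding lepoll_def by (intro exI[of _ "\<lambda>t. Complex 1 t *s x"]) auto
  qed
next
  fix x x' y :: "complex^2"
  assume "x \<noteq> 0" "x' \<noteq> 0" "y \<noteq> 0" "(x, y) \<in> Gamma0 N" "(x', y) \<in> Gamma0 N"
  then have "x \<perp> w \<longleftrightarrow> x' \<perp> w" for w
    using det unfolding nbhd_determined_def Gamma0_def by blast
  then show "Gamma0 N `` {x} = Gamma0 N `` {x'}" by (auto simp: Gamma0_def)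
qed

end

section \<open>The Hilbert plane\<close>

definition herm :: "complex^2 \<Rightarrow> complex^2 \<Rightarrow> complex" where
  "herm x y = x $ 1 * cnj (y $ 1) + x $ 2 * cnj (y $ 2)"

text \<open>This vector spans the Hilbert orthogonal complement of a nonzero \<open>y\<close> and
  turns the inner product into a \<open>wedge\<close>.\<close>

definition perp_vec :: "complex^2 \<Rightarrow> complex^2" where
  "perp_vec y = vector [- cnj (y $ 2), cnj (y $ 1)]"

lemma herm_eq_wedge: "herm x y = wedge x (perp_vec y)"
  by (simp add: herm_def wedge_def perp_vec_def)

lemma perp_vec_eq_0_iff: "perp_vec y = 0 \<longleftrightarrow> y = 0"
  by (auto simp: perp_vec_def vec_eq_iff forall_2)

lemma hilbert_norm_eq_norm: "hilbert_norm v = norm v"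
  by (simp add: hilbert_norm_def norm_vec_def L2_set_def UNIV_2)

interpretation hilbert: planar_norm hilbert_norm
proof
  have "hilbert_norm (c *s x) = cmod c * hilbert_norm x" for c x
    by (simp add: hilbert_norm_def norm_mult power_mult_distrib real_sqrt_mult flip: distrib_left)
  then show "complex_norm hilbert_norm"
    unfolding complex_norm_def by (auto simp: hilbert_norm_eq_norm norm_triangle_ineq)
qed

lemma hilbert_norm_add_smult:
  "(hilbert_norm (x + c *s y))\<^sup>2 =
     (hilbert_norm x)\<^sup>2 + 2 * Re (cnj c * herm x y) + (cmod c)\<^sup>2 * (hilbert_norm y)\<^sup>2"
proof -
  have sq: "(hilbert_norm v)\<^sup>2 = (cmod (v $ 1))\<^sup>2 + (cmod (v $ 2))\<^sup>2" for v
    by (simp add: hilbert_norm_def)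
  have "(cmod (a + c * b))\<^sup>2 = (cmod a)\<^sup>2 + 2 * Re (cnj c * (a * cnj b)) + (cmod c)\<^sup>2 * (cmod b)\<^sup>2" for a b
    unfolding cmod_power2 by (simp add: power2_eq_square) algebra
  then show ?thesis by (simp add: sq herm_def distrib_left)
qed

lemma hilbert_BJ_iff: "BJ_orthogonal hilbert_norm x y \<longleftrightarrow> herm x y = 0"
proof
  assume o: "BJ_orthogonal hilbert_norm x y"
  show "herm x y = 0"
  proof (cases "y = 0")
    case False
    define n where "n = (hilbert_norm y)\<^sup>2"
    have n: "0 < n" unfolding n_def by (intro zero_less_power hilbert.N_pos False)
    \<comment> \<open>This coefficient subtracts from \<open>x\<close> its orthogonal projection
      onto the line of \<open>y\<close>, which minimises the norm.\<close>
    define c where "c = - herm x y / of_real n"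
    have "(hilbert_norm x)\<^sup>2 \<le> (hilbert_norm (x + c *s y))\<^sup>2"
      using o by (intro power_mono) (auto simp: BJ_orthogonal_def)
    also have "\<dots> = (hilbert_norm x)\<^sup>2 + 2 * Re (cnj c * herm x y) + (cmod c)\<^sup>2 * n"
      by (simp add: hilbert_norm_add_smult n_def)
    also have "cnj c * herm x y = of_real (- (cmod (herm x y))\<^sup>2 / n)"
      using complex_norm_square[of "herm x y"] by (simp add: c_def mult.commute)
    also have "(cmod c)\<^sup>2 * n = (cmod (herm x y))\<^sup>2 / n"
      using n by (simp add: c_def norm_divide power_divide power2_eq_square)
    finally have "(cmod (herm x y))\<^sup>2 / n \<le> 0" by simp
    then show ?thesis using n by (simp add: divide_le_0_iff)
  qed (simp add: herm_def)
next
  assume 0: "herm x y = 0"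
  show "BJ_orthogonal hilbert_norm x y"
    unfolding BJ_orthogonal_def
    by (rule allI, rule power2_le_imp_le) (simp_all add: hilbert_norm_add_smult 0)
qed

lemma hilbert_BJ_sym:
  "\<forall>x y. BJ_orthogonal hilbert_norm x y \<longrightarrow> BJ_orthogonal hilbert_norm y x"
proof (intro allI impI)
  fix x y
  have "herm y x = cnj (herm x y)" by (simp add: herm_def mult.commute)
  then show "BJ_orthogonal hilbert_norm x y \<Longrightarrow> BJ_orthogonal hilbert_norm y x"
    by (simp add: hilbert_BJ_iff)
qed

text \<open>The vectors orthogonal to a nonzero \<open>y\<close> form the line of
  \<open>perp_vec y\<close>, so \<open>x\<close> and \<open>x'\<close> are multiples of the same
  vector.\<close>

lemma hilbert_nbhd_determined: "hilbert.nbhd_determined"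
  unfolding hilbert.nbhd_determined_def
proof (intro allI impI, elim conjE)
  fix x x' y w
  assume a: "x \<noteq> 0" "x' \<noteq> 0" "y \<noteq> 0" "BJ_orthogonal hilbert_norm x y"
    "BJ_orthogonal hilbert_norm x' y" "BJ_orthogonal hilbert_norm x w"
  have "wedge (perp_vec y) x = 0" "wedge (perp_vec y) x' = 0"
    using a(4,5) wedge_swap[of x] wedge_swap[of x'] by (auto simp: hilbert_BJ_iff herm_eq_wedge)
  then obtain c c' where c: "x = c *s perp_vec y" "x' = c' *s perp_vec y"
    using wedge_eq_0_iff[of "perp_vec y"] a(3) perp_vec_eq_0_iff by blast
  then show "BJ_orthogonal hilbert_norm x' w"
    using a(1,6) by (auto simp: hilbert_BJ_iff herm_eq_wedge wedge_simps)
qed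

lemma range_out_perp_hilbert: "range (out_perp hilbert_norm) \<approx> (UNIV :: real set)"
proof (rule lepoll_antisym)
  show "range (out_perp hilbert_norm) \<lesssim> (UNIV :: real set)"
    by (rule lepoll_trans[OF image_lepoll complex2_lepoll_real])
  have "inj (\<lambda>t :: real. out_perp hilbert_norm (vector [1, of_real t]))"
  proof (rule injI)
    fix s t :: real
    assume eq: "out_perp hilbert_norm (vector [1, of_real s]) = out_perp hilbert_norm (vector [1, of_real t])"
    \<comment> \<open>The test vector for \<open>s\<close> is orthogonal to exactly one member of
      the real family, so the neighbourhoods of its members are distinct.\<close>
    have iff: "vector [- of_real s, 1] \<in> out_perp hilbert_norm (vector [1, of_real r]) \<longleftrightarrow> r = s" for r
      by (simp add: out_perp_def Gamma0_def hilbert_BJ_iff herm_def flip: of_real_add of_real_minus)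
    show "s = t" using iff[of s] iff[of t] unfolding eq by blast
  qed
  then show "(UNIV :: real set) \<lesssim> range (out_perp hilbert_norm)"
    unfolding lepoll_def by (intro exI[of _ "\<lambda>t. out_perp hilbert_norm (vector [1, of_real t])"]) auto
qed

lemma Gamma0_hilbert_isomorphic_biclique_sum:
  "digraph_isomorphic (Gamma0 hilbert_norm) biclique_sum"
proof -
  have "biclique_graph (Gamma0 hilbert_norm) 0"
    using hilbert_BJ_sym hilbert_nbhd_determined range_out_perp_hilbert
    by (rule hilbert.biclique_graph_Gamma0)
  then interpret biclique_graph "Gamma0 hilbert_norm" 0 .
  show ?thesis by (rule isomorphic_biclique_sum)
qed

section \<open>Transfer from the Hilbert plane and the equivalence\<close>

context planar_norm
begin

lemma nbhd_determined_if_isomorphic_hilbert: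
  assumes "digraph_isomorphic (Gamma0 N) (Gamma0 hilbert_norm)"
  shows nbhd_determined
proof -
  obtain \<phi> where \<phi>: "bij \<phi>" "\<And>x y. x \<perp> y \<longleftrightarrow> BJ_orthogonal hilbert_norm (\<phi> x) (\<phi> y)"
    using assms by (auto simp: digraph_isomorphic_def Gamma0_def)
  \<comment> \<open>Zero is the only vertex with a loop, so every isomorphism fixes it, and
    \<open>nbhd_determined\<close> is phrased by edges and zero alone.\<close>
  have "\<phi> x = 0 \<longleftrightarrow> x = 0" for x
    using \<phi>(2)[of x x] by (simp add: BJ_refl_iff hilbert.BJ_refl_iff)
  then show ?thesis
    using hilbert_nbhd_determined
    unfolding nbhd_determined_def hilbert.nbhd_determined_def \<phi>(2) by metis
qed

end

theorem lemma3p12: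
  fixes R :: "complex^2 \<Rightarrow> real"
  assumes "complex_Radon_plane R"
  shows "digraph_isomorphic (Gamma0 R) (Gamma0 hilbert_norm) \<longleftrightarrow>
           face_boundaries_smooth R \<and> range (out_perp R) \<approx> (UNIV :: real set)"
proof -
  interpret planar_norm R
    using assms by unfold_locales (simp add: complex_Radon_plane_def)
  have sym: "\<forall>x y. BJ_orthogonal R x y \<longrightarrow> BJ_orthogonal R y x"
    using assms by (simp add: complex_Radon_plane_def)
  have mate: "\<exists>y. y \<noteq> 0 \<and> BJ_orthogonal R x y" if "x \<noteq> 0" for x
    using exists_BJ_left[OF that] sym by blast
  show ?thesis
  proof (intro iffI conjI; (elim conjE)?)
    assume iso: "digraph_isomorphic (Gamma0 R) (Gamma0 hilbert_norm)"
    show "face_boundaries_smooth R"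
      using iso mate
      by (intro face_boundaries_smooth_if_nbhd_determined nbhd_determined_if_isomorphic_hilbert)
    show "range (out_perp R) \<approx> (UNIV :: real set)"
      using digraph_isomorphic_range_Image[OF iso] range_out_perp_hilbert
      by (auto simp: out_perp_eq_Image[abs_def] intro: eqpoll_trans)
  next
    assume smooth: "face_boundaries_smooth R"
      and continuum: "range (out_perp R) \<approx> (UNIV :: real set)"
    have "biclique_graph (Gamma0 R) 0"
      by (rule biclique_graph_Gamma0[OF sym nbhd_determined_if_face_boundaries_smooth[OF smooth]
            continuum])
    then have "digraph_isomorphic (Gamma0 R) biclique_sum"
      by (rule biclique_graph.isomorphic_biclique_sum)
    then show "digraph_isomorphic (Gamma0 R) (Gamma0 hilbert_norm)"
      using Gamma0_hilbert_isomorphic_biclique_sum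
        digraph_isomorphic_sym digraph_isomorphic_trans by blast
  qed
qed

end
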